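(* Let $B$ be a compact Hausdorff space and let $R$ be a positive linear operator, $R:C(B)\to C(B)$ or $R:M(B)\to M(B)$, with $R1=1$. Then for each $x\in B$ there exists a unique (regular) Borel probability measure $\mathbb{P}_x$ on $B^{\mathbb{N}}$ such that $$\int_{B^{\mathbb{N}}}\varphi_1\otimes\dots\otimes\varphi_n\,d\mathbb{P}_x=\left(M_{\varphi_1}RM_{\varphi_2}\cdots RM_{\varphi_n}1\right)(x)$$ for all $n\in\mathbb{N}$ and all $\varphi_1,\dots,\varphi_n\in C(B)$.
   Context: $\mathbb{N}=\{1,2,\dots\}$; $C(B)$ is the space of continuous functions $B\to\mathbb{R}$ and $M(B)$ the space of all Borel measurable functions on $B$. $R$ is called positive if $\varphi\ge 0$ on $B$ implies $R\varphi\ge 0$ on $B$. $1$ denotes the constant function $1$. $M_\varphi$ is the multiplication operator $M_\varphi f=\varphi f$. $B^{\mathbb{N}}$ carries the product topology (it is compact). For $\tilde x=(x_1,x_2,\dots)\in B^{\mathbb{N}}$, $(\varphi_1\otimes\dots\otimes\varphi_n)(\tilde x)=\varphi_1(x_1)\varphi_2(x_2)\cdots\varphi_n(x_n)$. Borel measures on compact Hausdorff spaces are understood to be regular. *)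

theory Defs
  imports "HOL-Probability.Probability"
begin

text \<open>The two function spaces \<open>C(B)\<close> and \<open>M(B)\<close>, where \<open>B\<close> is the whole
  carrier of the type. Neither is a type of its own, so an operator on them is a function on all
  of \<open>'a \<Rightarrow> real\<close> of which only the restriction to the space is ever used.\<close>

definition C_space :: "('a::topological_space \<Rightarrow> real) set" where
  "C_space = {\<phi>. continuous_on UNIV \<phi>}"

definition M_space :: "('a::topological_space \<Rightarrow> real) set" where
  "M_space = borel_measurable borel"

definition linear_operator_on ::
    "('a \<Rightarrow> real) set \<Rightarrow> (('a \<Rightarrow> real) \<Rightarrow> ('a \<Rightarrow> real)) \<Rightarrow> bool" where
  "linear_operator_on V R \<longleftrightarrow>
     (\<forall>f\<in>V. R f \<in> V) \<and>
     (\<forall>f\<in>V. \<forall>g\<in>V. R (\<lambda>y. f y + g y) = (\<lambda>y. R f y + R g y)) \<and>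
     (\<forall>c. \<forall>f\<in>V. R (\<lambda>y. c * f y) = (\<lambda>y. c * R f y))"

definition positive_operator_on ::
    "('a \<Rightarrow> real) set \<Rightarrow> (('a \<Rightarrow> real) \<Rightarrow> ('a \<Rightarrow> real)) \<Rightarrow> bool" where
  "positive_operator_on V R \<longleftrightarrow> (\<forall>\<phi>\<in>V. (\<forall>y. 0 \<le> \<phi> y) \<longrightarrow> (\<forall>y. 0 \<le> R \<phi> y))"

definition mult_op :: "('a \<Rightarrow> real) \<Rightarrow> ('a \<Rightarrow> real) \<Rightarrow> ('a \<Rightarrow> real)" where
  "mult_op \<phi> f = (\<lambda>y. \<phi> y * f y)"

text \<open>\<open>op_word R [\<phi>\<^sub>1, \<dots>, \<phi>\<^sub>n]\<close> is the operator \<open>M(\<phi>\<^sub>1) R M(\<phi>\<^sub>2) \<cdots> R M(\<phi>\<^sub>n)\<close>, with \<open>R\<close> only between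
  consecutive multiplications. The value on the empty list is a dummy.\<close>

fun op_word ::
    "(('a \<Rightarrow> real) \<Rightarrow> ('a \<Rightarrow> real)) \<Rightarrow> ('a \<Rightarrow> real) list \<Rightarrow> ('a \<Rightarrow> real) \<Rightarrow> ('a \<Rightarrow> real)" where
  "op_word R [] = id"
| "op_word R [\<phi>] = mult_op \<phi>"
| "op_word R (\<phi> # \<psi> # \<phi>s) = mult_op \<phi> \<circ> R \<circ> op_word R (\<psi> # \<phi>s)"

text \<open>Sequences and lists are indexed from 0, so the coordinate \<open>x\<^sub>i\<close> of a point of the
  product \<open>B\<^sup>\<nat>\<close>, \<open>\<nat> = {1, 2, \<dots>}\<close>, is \<open>\<omega> (i - 1)\<close>.\<close>

definition tensor :: "('a \<Rightarrow> real) list \<Rightarrow> (nat \<Rightarrow> 'a) \<Rightarrow> real" where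
  "tensor \<phi>s \<omega> = (\<Prod>i<length \<phi>s. (\<phi>s ! i) (\<omega> i))"

definition regular_measure :: "'b::topological_space measure \<Rightarrow> bool" where
  "regular_measure M \<longleftrightarrow>
     (\<forall>A\<in>sets M. emeasure M A = (SUP K\<in>{K. K \<subseteq> A \<and> compact K}. emeasure M K) \<and>
                 emeasure M A = (INF U\<in>{U. A \<subseteq> U \<and> open U}. emeasure M U))"

text \<open>The Borel sigma-algebra is that of the topology of \<open>'b\<close>; for \<open>'b = nat \<Rightarrow> 'a\<close> this is the
  product topology, and the Borel sets may properly contain the product sigma-algebra when \<open>'a\<close>
  is not second countable.\<close>

definition regular_borel_prob :: "'b::topological_space measure \<Rightarrow> bool" where
  "regular_borel_prob P \<longleftrightarrow> sets P = sets borel \<and> prob_space P \<and> regular_measure P"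

end

theory Submission
  imports Defs
begin

text \<open>On linear combinations of tensors, positivity of the prescribed functional
  \<open>tensor \<phi>s \<mapsto> op_word R \<phi>s 1 x\<close> follows by induction on the length of the words, freezing the first
  coordinate, applying \<open>R\<close> and evaluating at the frozen point. Positivity also makes the functional
  well defined and, as it maps 1 to 1, bounded; Stone--Weierstrass extends it uniquely to all
  continuous functions on the compact product, and the Riesz--Markov theorem represents the
  extension by a regular Borel probability measure, obtained from the outer measure that the
  functional induces. A regular measure is determined by its integrals of continuous functions
  through Urysohn functions.\<close>

section \<open>Products of compact Hausdorff spaces\<close>

text \<open>Iterated transition kernels would produce a measure on the product sigma-algebra, which
  can be smaller than the Borel sets of \<open>nat \<Rightarrow> 'a\<close>. Representing a
  functional on the whole compact product yields a Borel measure at once, and regularity is what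
  carries uniqueness beyond the product sigma-algebra. Positivity has to be proved for all starting
  points simultaneously: a combination of shorter words must be nonnegative as a function before
  \<open>R\<close> can be applied to it. For \<open>V = M_space\<close> the values of words need not
  depend continuously on the starting point, so continuity is only ever asked of functions on the
  product. One function can be a combination of tensors in many ways, and independence of the way is
  known only after positivity. The functional therefore starts as a relation between functions and
  values.\<close>

lemma open_coordinate_vimage:
  fixes W :: "'b::topological_space set"
  shows "open W \<Longrightarrow> open ((\<lambda>f. f i) -` W)"
  by (rule open_vimage[OF _ continuous_on_product_coordinates])

text \<open>The library knows separation of function spaces only for countable index types and metric
  codomains; coregularity of sorts forces the three axioms to be added from the weakest up.\<close>

instance "fun" :: (type, t0_space) t0_space
proof
  fix f g :: "'a \<Rightarrow> 'b"
  assume "f \<noteq> g"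
  then obtain i where "f i \<noteq> g i" by auto
  then obtain U where U: "open U" "\<not> (f i \<in> U \<longleftrightarrow> g i \<in> U)"
    using separation_t0[of "f i" "g i"] by blast
  show "\<exists>U. open U \<and> \<not> (f \<in> U \<longleftrightarrow> g \<in> U)"
    by (rule exI[of _ "(\<lambda>h. h i) -` U"]) (use U in \<open>simp add: open_coordinate_vimage\<close>)
qed

instance "fun" :: (type, t1_space) t1_space
proof
  fix f g :: "'a \<Rightarrow> 'b"
  assume "f \<noteq> g"
  then obtain i where "f i \<noteq> g i" by auto
  then obtain U where U: "open U" "f i \<in> U" "g i \<notin> U"
    using separation_t1[of "f i" "g i"] by blast
  show "\<exists>U. open U \<and> f \<in> U \<and> g \<notin> U"
    by (rule exI[of _ "(\<lambda>h. h i) -` U"]) (use U in \<open>simp add: open_coordinate_vimage\<close>)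
qed

instance "fun" :: (type, t2_space) t2_space
proof
  fix f g :: "'a \<Rightarrow> 'b"
  assume "f \<noteq> g"
  then obtain i where "f i \<noteq> g i" by auto
  then obtain U V
    where UV: "open U" "open V" "f i \<in> U" "g i \<in> V" "U \<inter> V = {}"
    using separation_t2[of "f i" "g i"] by blast
  show "\<exists>U V. open U \<and> open V \<and> f \<in> U \<and> g \<in> V \<and> U \<inter> V = {}"
    by (rule exI[of _ "(\<lambda>h. h i) -` U"], rule exI[of _ "(\<lambda>h. h i) -` V"])
      (use UV in \<open>auto simp: open_coordinate_vimage\<close>)
qed

text \<open>Tychonoff's theorem for abstract topologies, carried over to the type class because the
  topology of a function type is the product of the euclidean ones.\<close>

lemma compact_UNIV_fun:
  assumes "compact (UNIV :: 'b::topological_space set)"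
  shows "compact (UNIV :: ('a \<Rightarrow> 'b) set)"
proof -
  have "compact_space (product_topology (\<lambda>i::'a. euclidean :: 'b topology) UNIV)"
    unfolding compact_space_product_topology using assms by (simp add: compact_space_def)
  then show ?thesis
    by (simp only: euclidean_product_topology compact_space_def topspace_euclidean compactin_euclidean_iff)
qed

lemma Urysohn_compact_t2:
  fixes S T :: "'b::t2_space set"
  assumes "compact (UNIV :: 'b set)" "closed S" "closed T" "S \<inter> T = {}"
  obtains f :: "'b \<Rightarrow> real" where "continuous_on UNIV f" "\<And>x. 0 \<le> f x" "\<And>x. f x \<le> 1"
    "\<And>x. x \<in> S \<Longrightarrow> f x = 0" "\<And>x. x \<in> T \<Longrightarrow> f x = 1"
proof -
  have "Hausdorff_space (euclidean :: 'b topology)"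
    unfolding Hausdorff_space_def disjnt_def open_openin[symmetric] using hausdorff by blast
  moreover have "compact_space (euclidean :: 'b topology)"
    using assms by (simp add: compact_space_def)
  ultimately have "normal_space (euclidean :: 'b topology)"
    using compact_Hausdorff_or_regular_imp_normal_space by blast
  then obtain f :: "'b \<Rightarrow> real" where f: "continuous_map euclidean (top_of_set {0..1}) f"
      "f ` S \<subseteq> {0}" "f ` T \<subseteq> {1}"
    using Urysohn_lemma[of euclidean S T 0 1] assms by (auto simp: disjnt_def)
  have "continuous_on UNIV f" "range f \<subseteq> {0..1}"
    using f(1) by (auto simp: continuous_map_in_subtopology)
  then show ?thesis using f(2,3) by (intro that[of f]) (auto simp: image_subset_iff)
qed

section \<open>Positive functionals and the Riesz--Markov theorem\<close>

text \<open>The set \<open>G\<close> is the graph of a functional that may a priori be multivalued.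
  Positivity and the constant 1 bound differences of values by uniform distances of functions. This
  excludes two values for one function and lets values pass to uniform limits.\<close>

lemma positive_extension:
  fixes G :: "(('b::topological_space \<Rightarrow> real) \<times> real) set"
  assumes add: "\<And>f g r s. (f, r) \<in> G \<Longrightarrow> (g, s) \<in> G \<Longrightarrow> (\<lambda>x. f x + g x, r + s) \<in> G"
    and scale: "\<And>c f r. (f, r) \<in> G \<Longrightarrow> (\<lambda>x. c * f x, c * r) \<in> G"
    and nonneg: "\<And>f r. (f, r) \<in> G \<Longrightarrow> (\<And>x. 0 \<le> f x) \<Longrightarrow> 0 \<le> r"
    and one: "(\<lambda>_. 1, 1) \<in> G"
    and dense: "\<And>f e. continuous_on UNIV f \<Longrightarrow> 0 < e \<Longrightarrow>
                  \<exists>g r. (g, r) \<in> G \<and> (\<forall>x. \<bar>f x - g x\<bar> < e)"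
  obtains L :: "('b \<Rightarrow> real) \<Rightarrow> real" where
    "\<And>g r. (g, r) \<in> G \<Longrightarrow> continuous_on UNIV g \<Longrightarrow> L g = r"
    "\<And>f g. continuous_on UNIV f \<Longrightarrow> continuous_on UNIV g \<Longrightarrow> L (\<lambda>x. f x + g x) = L f + L g"
    "\<And>c f. continuous_on UNIV f \<Longrightarrow> L (\<lambda>x. c * f x) = c * L f"
    "\<And>f. continuous_on UNIV f \<Longrightarrow> \<forall>x. 0 \<le> f x \<Longrightarrow> 0 \<le> L f"
proof -
  have mono: "r \<le> s + e" if "(f, r) \<in> G" "(g, s) \<in> G" "\<And>x. f x \<le> g x + e" for f g r s e
  proof -
    have "(\<lambda>x. (g x + e * 1) + (-1) * f x, (s + e * 1) + (-1) * r) \<in> G"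
      by (intro add scale one that)
    from nonneg[OF this] show ?thesis using that(3) by (auto simp: algebra_simps)
  qed
  define approx where "approx f t \<longleftrightarrow>
    (\<forall>e>0. \<forall>g r. (g, r) \<in> G \<longrightarrow> (\<forall>x. \<bar>f x - g x\<bar> \<le> e) \<longrightarrow> \<bar>t - r\<bar> \<le> e)"
    for f :: "'b \<Rightarrow> real" and t
  define L where "L f = (SOME t. approx f t)" for f
  have L: "\<bar>L f - r\<bar> \<le> e"
    if "continuous_on UNIV f" "(g, r) \<in> G" "0 < e" "\<And>x. \<bar>f x - g x\<bar> \<le> e" for f g r e
  proof -
    \<comment> \<open>Each approximant bounds the value to be chosen by \<open>r + e\<close> from
      above and \<open>r - e\<close> from below. By \<open>lower\<close>, every lower bound lies
      under every upper bound, so the infimum of the upper bounds respects all approximants at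
      once.\<close>
    define S where "S = {r + e |g r e. 0 < e \<and> (g, r) \<in> G \<and> (\<forall>x. \<bar>f x - g x\<bar> \<le> e)}"
    have lower: "s - d \<le> y" if "y \<in> S" "0 < d" "(h, s) \<in> G" "\<forall>x. \<bar>f x - h x\<bar> \<le> d" for y d h s
    proof -
      from that(1) obtain g r e where g: "y = r + e" "(g, r) \<in> G" "\<forall>x. \<bar>f x - g x\<bar> \<le> e"
        unfolding S_def by auto
      have "h x \<le> g x + (e + d)" for x
        using spec[OF g(3), of x] spec[OF that(4), of x] by linarith
      from mono[OF that(3) g(2) this] show ?thesis using g(1) by simp
    qed
    have "approx f (Inf S)"
      unfolding approx_def
    proof (intro allI impI)
      fix d h s assume d: "0 < d" "(h, s) \<in> G" "\<forall>x. \<bar>f x - h x\<bar> \<le> d"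
      have "s + d \<in> S" unfolding S_def using d by blast
      moreover have "bdd_below S" using lower[OF _ d] by (meson bdd_belowI)
      ultimately have "Inf S \<le> s + d" "s - d \<le> Inf S"
        using lower[OF _ d] by (auto intro: cInf_lower cInf_greatest)
      then show "\<bar>Inf S - s\<bar> \<le> d" by linarith
    qed
    then have "approx f (L f)" unfolding L_def by (rule someI)
    then show ?thesis using that unfolding approx_def by blast
  qed
  have eqI: "a = b" if "\<And>e. 0 < e \<Longrightarrow> \<bar>a - b\<bar> \<le> k * e" "0 < k" for a b k :: real
  proof (rule ccontr)
    assume "a \<noteq> b"
    with that(1)[of "\<bar>a - b\<bar> / (2 * k)"] that(2) show False by (simp add: field_simps)
  qed
  show ?thesis
  proof
    fix g r assume g: "(g, r) \<in> G" "continuous_on UNIV g"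
    show "L g = r"
      by (rule eqI[of _ _ 1]) (simp_all add: L[OF g(2,1)])
  next
    fix f g :: "'b \<Rightarrow> real" assume fg: "continuous_on UNIV f" "continuous_on UNIV g"
    have fg': "continuous_on UNIV (\<lambda>x. f x + g x)" by (intro continuous_intros fg)
    show "L (\<lambda>x. f x + g x) = L f + L g"
    \<comment> \<open>One \<open>e\<close> each for \<open>f\<close> and \<open>g\<close>, and
      \<open>2 * e\<close> for their sum.\<close>
    proof (rule eqI[of _ _ 4])
      fix e :: real assume e: "0 < e"
      obtain f' r where f': "(f', r) \<in> G" "\<forall>x. \<bar>f x - f' x\<bar> < e" using dense[OF fg(1) e] by blast
      obtain g' s where g': "(g', s) \<in> G" "\<forall>x. \<bar>g x - g' x\<bar> < e" using dense[OF fg(2) e] by blast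
      have bd: "\<bar>f x - f' x\<bar> \<le> e" "\<bar>g x - g' x\<bar> \<le> e" for x
        using f'(2) g'(2) by (auto intro: less_imp_le)
      have bd2: "\<bar>(f x + g x) - (f' x + g' x)\<bar> \<le> 2 * e" for x
        using bd[of x] by linarith
      show "\<bar>L (\<lambda>x. f x + g x) - (L f + L g)\<bar> \<le> 4 * e"
        using L[OF fg(1) f'(1) e bd(1)] L[OF fg(2) g'(1) e bd(2)]
          L[OF fg' add[OF f'(1) g'(1)] _ bd2] e by linarith
    qed simp
  next
    fix c and f :: "'b \<Rightarrow> real" assume f: "continuous_on UNIV f"
    have cf: "continuous_on UNIV (\<lambda>x. c * f x)" by (intro continuous_intros f)
    show "L (\<lambda>x. c * f x) = c * L f"
    proof (rule eqI[of _ _ "2 * \<bar>c\<bar> + 1"])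
      fix e :: real assume e: "0 < e"
      obtain f' r where f': "(f', r) \<in> G" "\<forall>x. \<bar>f x - f' x\<bar> < e" using dense[OF f e] by blast
      have bd: "\<bar>f x - f' x\<bar> \<le> e" for x using f'(2) by (auto intro: less_imp_le)
      have "\<bar>c * f x - c * f' x\<bar> \<le> \<bar>c\<bar> * e" for x
        using mult_left_mono[OF bd[of x], of "\<bar>c\<bar>"] by (simp flip: abs_mult add: right_diff_distrib)
      \<comment> \<open>The additional \<open>e\<close> keeps the tolerance strictly positive when
        \<open>c = 0\<close>; it is the 1 in \<open>2 * \<bar>c\<bar> + 1\<close>.\<close>
      then have bd2: "\<bar>c * f x - c * f' x\<bar> \<le> \<bar>c\<bar> * e + e" for x
        using e by (meson add_increasing2 less_imp_le order_trans order_refl)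
      have "\<bar>L (\<lambda>x. c * f x) - c * r\<bar> \<le> \<bar>c\<bar> * e + e"
        using L[OF cf scale[OF f'(1)] _ bd2] e by (simp add: add_nonneg_pos)
      moreover have "\<bar>c * L f - c * r\<bar> \<le> \<bar>c\<bar> * e"
        using mult_left_mono[OF L[OF f f'(1) e bd], of "\<bar>c\<bar>"]
        by (simp flip: abs_mult add: right_diff_distrib)
      ultimately show "\<bar>L (\<lambda>x. c * f x) - c * L f\<bar> \<le> (2 * \<bar>c\<bar> + 1) * e"
        by (simp add: algebra_simps abs_le_iff)
    qed simp
  next
    fix f :: "'b \<Rightarrow> real" assume f: "continuous_on UNIV f" "\<forall>x. 0 \<le> f x"
    have "- L f \<le> 0 + e" if e: "0 < e" for e
    proof -
      obtain g r where g: "(g, r) \<in> G" "\<forall>x. \<bar>f x - g x\<bar> < e/2"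
        using dense[OF f(1), of "e/2"] e by auto
      have bd: "\<bar>f x - g x\<bar> \<le> e/2" for x using g(2) by (auto intro: less_imp_le)
      \<comment> \<open>The left side is the value of the zero function, which lies in
        \<open>G\<close> as the multiple \<open>0 * 1\<close> of the constant 1.\<close>
      have "0 * 1 \<le> r + e/2"
        by (rule mono[OF scale[OF one] g(1)]) (use bd[unfolded abs_le_iff] f(2) in \<open>smt (verit)\<close>)
      then show ?thesis using L[OF f(1) g(1) _ bd] e by linarith
    qed
    then have "- L f \<le> 0" by (rule field_le_epsilon)
    then show "0 \<le> L f" by simp
  qed
qed

lemma integrable_continuous_compact:
  fixes f :: "'b::topological_space \<Rightarrow> real"
  assumes "compact (UNIV :: 'b set)" "prob_space P" "sets P = sets borel" "continuous_on UNIV f"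
  shows "integrable P f"
proof -
  interpret P: prob_space P by fact
  have "bounded (range f)"
    using compact_continuous_image[OF assms(4,1)] by (rule compact_imp_bounded)
  then obtain B where "\<And>x. norm (f x) \<le> B" by (auto simp: bounded_iff)
  moreover have "f \<in> borel_measurable P"
    using borel_measurable_continuous_onI[OF assms(4)] assms(3)
    by (simp cong: measurable_cong_sets)
  ultimately show ?thesis by (intro P.integrable_const_bound) auto
qed

section \<open>The outer measure induced by a normalized positive functional\<close>

locale positive_functional =
  fixes L :: "('b::t2_space \<Rightarrow> real) \<Rightarrow> real"
  assumes compact_UNIV: "compact (UNIV :: 'b set)"
    and add: "continuous_on UNIV f \<Longrightarrow> continuous_on UNIV g \<Longrightarrow> L (\<lambda>x. f x + g x) = L f + L g"
    and scale: "continuous_on UNIV f \<Longrightarrow> L (\<lambda>x. c * f x) = c * L f"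
    and nonneg: "continuous_on UNIV f \<Longrightarrow> (\<And>x. 0 \<le> f x) \<Longrightarrow> 0 \<le> L f"
    and one: "L (\<lambda>_. 1) = 1"
begin

lemma const: "L (\<lambda>_. c) = c"
  using scale[of "\<lambda>_. 1" c] one by simp

lemma diff:
  assumes "continuous_on UNIV f" "continuous_on UNIV g"
  shows "L (\<lambda>x. f x - g x) = L f - L g"
  using add[of f "\<lambda>x. (-1) * g x"] scale[of g "-1"] assms
  by (simp add: continuous_on_minus)

lemma mono:
  assumes "continuous_on UNIV f" "continuous_on UNIV g" "\<And>x. f x \<le> g x"
  shows "L f \<le> L g"
  using nonneg[of "\<lambda>x. g x - f x"] diff[of g f] assms by (simp add: continuous_on_diff)

lemma sum:
  fixes n :: nat
  assumes "\<And>i. i < n \<Longrightarrow> continuous_on UNIV (f i)"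
  shows "L (\<lambda>x. \<Sum>i<n. f i x) = (\<Sum>i<n. L (f i))"
  using assms
proof (induction n)
  case 0
  then show ?case using const[of 0] by simp
next
  case (Suc n)
  have "continuous_on UNIV (\<lambda>x. \<Sum>i<n. f i x)"
    using Suc.prems by (intro continuous_on_sum) auto
  from add[OF this, of "f n"] show ?case using Suc by simp
qed

text \<open>Functions here only vanish off \<open>U\<close>, whereas the usual construction asks for
  a support inside \<open>U\<close>. The lemma \<open>truncate\<close> bridges the difference:
  replacing \<open>f\<close> by \<open>max (f - e) 0\<close> costs at most \<open>e\<close> and
  leaves a function that vanishes off a closed subset of \<open>U\<close>.\<close>

definition below :: "'b set \<Rightarrow> ('b \<Rightarrow> real) set" where
  "below U = {f. continuous_on UNIV f \<and> (\<forall>x. 0 \<le> f x \<and> f x \<le> 1) \<and> (\<forall>x. x \<notin> U \<longrightarrow> f x = 0)}"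

definition content :: "'b set \<Rightarrow> ennreal" where
  "content U = (SUP f\<in>below U. ennreal (L f))"

definition outer :: "'b set \<Rightarrow> ennreal" where
  "outer A = (INF U\<in>{U. open U \<and> A \<subseteq> U}. content U)"

lemma belowI:
  assumes "continuous_on UNIV f" "\<And>x. 0 \<le> f x" "\<And>x. f x \<le> 1" "\<And>x. x \<notin> U \<Longrightarrow> f x = 0"
  shows "f \<in> below U"
  using assms unfolding below_def by blast

lemma belowD:
  assumes "f \<in> below U"
  shows "continuous_on UNIV f" "0 \<le> f x" "f x \<le> 1" "x \<notin> U \<Longrightarrow> f x = 0" "0 \<le> L f"
  using assms nonneg[of f] unfolding below_def by auto

lemma L_le_content: "f \<in> below U \<Longrightarrow> ennreal (L f) \<le> content U"
  unfolding content_def by (rule SUP_upper)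

lemma zero_in_below: "(\<lambda>_. 0) \<in> below U"
  by (rule belowI) auto

lemma content_mono: "U \<subseteq> V \<Longrightarrow> content U \<le> content V"
  unfolding content_def by (rule SUP_subset_mono) (auto simp: below_def)

lemma content_le_one: "content U \<le> 1"
  unfolding content_def
proof (rule SUP_least)
  fix f assume f: "f \<in> below U"
  have "L f \<le> 1"
    using mono[of f "\<lambda>_. 1"] belowD[OF f] one by simp
  then show "ennreal (L f) \<le> 1" by (simp add: ennreal_le_1)
qed

lemma content_empty: "content {} = 0"
proof -
  have "below {} = {\<lambda>_. 0}"
    using zero_in_below[of "{}"] by (auto simp: below_def)
  then show ?thesis by (simp add: content_def const)
qed

lemma truncate:
  assumes f: "f \<in> below U" and e: "0 < e"
  shows "(\<lambda>x. max (f x - e) 0) \<in> below U" "L f \<le> L (\<lambda>x. max (f x - e) 0) + e"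
    "closed {x. e \<le> f x}" "{x. e \<le> f x} \<subseteq> U" "open {x. f x < e}"
proof -
  note bf = belowD[OF f]
  have c: "continuous_on UNIV (\<lambda>x. max (f x - e) 0)"
    by (intro continuous_intros bf)
  show "(\<lambda>x. max (f x - e) 0) \<in> below U"
  proof (rule belowI[OF c])
    fix x show "max (f x - e) 0 \<le> 1" using bf(3)[of x] e by simp
    show "max (f x - e) 0 = 0" if "x \<notin> U" using bf(4)[OF that] e by simp
  qed simp
  have "L f \<le> L (\<lambda>x. max (f x - e) 0 + e)"
    by (rule mono) (auto intro!: continuous_intros bf(1))
  also have "\<dots> = L (\<lambda>x. max (f x - e) 0) + e"
    using add[OF c, of "\<lambda>_. e"] const[of e] by simp
  finally show "L f \<le> L (\<lambda>x. max (f x - e) 0) + e" .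
  show "closed {x. e \<le> f x}" "open {x. f x < e}"
    by (auto intro!: closed_Collect_le open_Collect_less bf(1) continuous_intros)
  show "{x. e \<le> f x} \<subseteq> U"
    using bf(4) e by force
qed

text \<open>After truncation to \<open>h\<close>, the part of \<open>{x. e \<le> f x}\<close>
  outside \<open>V\<close> is closed and contained in \<open>U\<close>. A Urysohn function
  \<open>g\<close>, 0 off \<open>U\<close> and 1 on that part, splits \<open>h\<close> into
  \<open>h * g\<close>, which vanishes off \<open>U\<close>, and \<open>h * (1 - g)\<close>, which
  vanishes off \<open>V\<close>.\<close>

lemma content_Un:
  assumes "open U" "open V"
  shows "content (U \<union> V) \<le> content U + content V"
  unfolding content_def[of "U \<union> V"]
proof (rule SUP_least)
  fix f assume f: "f \<in> below (U \<union> V)"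
  show "ennreal (L f) \<le> content U + content V"
  proof (rule ennreal_le_epsilon)
    fix e :: real assume e: "0 < e"
    define h where "h x = max (f x - e) 0" for x
    note t = truncate[OF f e, folded h_def]
    note h = belowD[OF t(1)]
    have cl: "closed (- U)" "closed ({x. e \<le> f x} - V)" "- U \<inter> ({x. e \<le> f x} - V) = {}"
      using assms t(3,4) by (auto intro: closed_Diff)
    obtain g where g: "continuous_on UNIV g" "\<And>x. 0 \<le> g x" "\<And>x. g x \<le> (1::real)"
      "\<And>x. x \<in> - U \<Longrightarrow> g x = 0" "\<And>x. x \<in> {x. e \<le> f x} - V \<Longrightarrow> g x = 1"
      using Urysohn_compact_t2[OF compact_UNIV cl(1) cl(2) cl(3)] by blast
    have g1: "(\<lambda>x. h x * g x) \<in> below U"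
      by (rule belowI) (auto intro!: continuous_intros mult_le_one mult_nonneg_nonneg g h)
    have g2: "(\<lambda>x. h x * (1 - g x)) \<in> below V"
    proof (rule belowI)
      fix x assume "x \<notin> V"
      then show "h x * (1 - g x) = 0"
        using g(5)[of x] by (cases "e \<le> f x") (auto simp: h_def)
    qed (auto intro!: continuous_intros mult_le_one mult_nonneg_nonneg g h)
    have "L h = L (\<lambda>x. h x * g x + h x * (1 - g x))"
      by (simp add: algebra_simps)
    also have "\<dots> = L (\<lambda>x. h x * g x) + L (\<lambda>x. h x * (1 - g x))"
      by (rule add[OF belowD(1)[OF g1] belowD(1)[OF g2]])
    finally have "L f \<le> L (\<lambda>x. h x * g x) + L (\<lambda>x. h x * (1 - g x)) + e"
      using t(2) by simp
    then have "ennreal (L f) \<le> ennreal (L (\<lambda>x. h x * g x) + L (\<lambda>x. h x * (1 - g x)) + e)"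
      by (rule ennreal_leI)
    also have "\<dots> = ennreal (L (\<lambda>x. h x * g x)) + ennreal (L (\<lambda>x. h x * (1 - g x))) + ennreal e"
      using belowD(5)[OF g1] belowD(5)[OF g2] e by (simp add: ennreal_plus)
    also have "\<dots> \<le> content U + content V + ennreal e"
      by (intro add_mono L_le_content g1 g2 order_refl)
    finally show "ennreal (L f) \<le> content U + content V + ennreal e" .
  qed
qed

lemma content_UN_lessThan:
  fixes U :: "nat \<Rightarrow> 'b set"
  assumes "\<And>i. open (U i)"
  shows "content (\<Union>i<n. U i) \<le> (\<Sum>i<n. content (U i))"
proof (induction n)
  case (Suc n)
  have "content (\<Union>i<Suc n. U i) = content ((\<Union>i<n. U i) \<union> U n)"
    by (simp add: lessThan_Suc Un_commute)
  also have "\<dots> \<le> content (\<Union>i<n. U i) + content (U n)"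
    by (intro content_Un open_UN assms ballI)
  also have "\<dots> \<le> (\<Sum>i<n. content (U i)) + content (U n)"
    by (intro add_mono Suc order_refl)
  finally show ?case by simp
qed (simp add: content_empty)

text \<open>Up to an error \<open>e\<close>, a competitor lives on the compact set
  \<open>{x. e \<le> f x}\<close>, which finitely many of the \<open>U i\<close> cover. This reduces
  the claim to finite unions.\<close>

lemma content_UN:
  fixes U :: "nat \<Rightarrow> 'b set"
  assumes "\<And>i. open (U i)"
  shows "content (\<Union>i. U i) \<le> (\<Sum>i. content (U i))"
  unfolding content_def[of "\<Union>i. U i"]
proof (rule SUP_least)
  fix f assume f: "f \<in> below (\<Union>i. U i)"
  show "ennreal (L f) \<le> (\<Sum>i. content (U i))"
  proof (rule ennreal_le_epsilon)
    fix e :: real assume e: "0 < e"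
    note t = truncate[OF f e]
    have "compact {x. e \<le> f x}"
      using t(3) compact_UNIV compact_Int_closed by fastforce
    then obtain I where I: "finite I" "{x. e \<le> f x} \<subseteq> (\<Union>i\<in>I. U i)"
      using compactE_image[of "{x. e \<le> f x}" UNIV U] assms t(4) by auto
    obtain n where n: "I \<subseteq> {..<n}" using finite_nat_bounded[OF I(1)] by blast
    have h: "(\<lambda>x. max (f x - e) 0) \<in> below (\<Union>i<n. U i)"
    proof (rule belowI)
      fix x assume "x \<notin> (\<Union>i<n. U i)"
      then have "x \<notin> {x. e \<le> f x}" using I(2) n by blast
      then show "max (f x - e) 0 = 0" by simp
    qed (use belowD[OF t(1)] in auto)
    have "ennreal (L f) \<le> ennreal (L (\<lambda>x. max (f x - e) 0) + e)"
      by (rule ennreal_leI[OF t(2)])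
    also have "\<dots> = ennreal (L (\<lambda>x. max (f x - e) 0)) + ennreal e"
      using belowD(5)[OF t(1)] e by (simp add: ennreal_plus)
    also have "\<dots> \<le> (\<Sum>i<n. content (U i)) + ennreal e"
      by (intro add_mono order_trans[OF L_le_content[OF h] content_UN_lessThan] assms order_refl)
    also have "\<dots> \<le> (\<Sum>i. content (U i)) + ennreal e"
      by (intro add_mono sum_le_suminf order_refl) auto
    finally show "ennreal (L f) \<le> (\<Sum>i. content (U i)) + ennreal e" .
  qed
qed

section \<open>Countable subadditivity and Caratheodory measurability of open sets\<close>

lemma outer_open: "open U \<Longrightarrow> outer U = content U"
  unfolding outer_def
  by (intro antisym INF_lower INF_greatest) (auto intro: content_mono)

lemma outer_mono: "A \<subseteq> B \<Longrightarrow> outer A \<le> outer B"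
  unfolding outer_def by (rule INF_superset_mono) auto

lemma outer_le_one: "outer A \<le> 1"
  using outer_mono[of A UNIV] outer_open[of UNIV] content_le_one[of UNIV] by simp

lemma outer_UN: "outer (\<Union>i. A i) \<le> (\<Sum>i. outer (A i))" for A :: "nat \<Rightarrow> 'b set"
proof (rule ennreal_le_epsilon)
  fix e :: real assume e: "0 < e"
  \<comment> \<open>Outer measures are at most 1, hence finite, so adding a positive slack gives a
    strict inequality and thereby an open set from the infimum. The slacks sum to
    \<open>e\<close>.\<close>
  have "\<exists>U. open U \<and> A i \<subseteq> U \<and> content U \<le> outer (A i) + e * (1/2) ^ Suc i" for i
  proof -
    have "outer (A i) < outer (A i) + ennreal (e * (1/2) ^ Suc i)"
      using e outer_le_one[of "A i"] le_less_trans[OF outer_le_one ennreal_one_less_top]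
      by (simp add: less_top)
    then show ?thesis
      unfolding outer_def[of "A i"] INF_less_iff by (auto intro: less_imp_le)
  qed
  then obtain U where U: "\<And>i. open (U i)" "\<And>i. A i \<subseteq> U i"
      "\<And>i. content (U i) \<le> outer (A i) + e * (1/2) ^ Suc i"
    by metis
  have "outer (\<Union>i. A i) \<le> outer (\<Union>i. U i)" using U(2) by (intro outer_mono) blast
  also have "\<dots> = content (\<Union>i. U i)" by (intro outer_open open_UN U ballI)
  also have "\<dots> \<le> (\<Sum>i. content (U i))" by (intro content_UN U)
  also have "\<dots> \<le> (\<Sum>i. outer (A i) + e * (1/2) ^ Suc i)"
    by (intro suminf_le U(3)) auto
  also have "\<dots> = (\<Sum>i. outer (A i)) + (\<Sum>i. ennreal e * ennreal ((1/2) ^ Suc i))"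
    using e by (subst suminf_add[symmetric])
               (auto simp del: ennreal_suminf_cmult simp add: ennreal_mult[symmetric])
  also have "\<dots> = (\<Sum>i. outer (A i)) + e"
    unfolding ennreal_suminf_cmult
    by (subst suminf_ennreal_eq[OF zero_le_power power_half_series]) auto
  finally show "outer (\<Union>i. A i) \<le> (\<Sum>i. outer (A i)) + ennreal e" .
qed

lemma outer_empty: "outer {} = 0"
  using outer_open[of "{}"] content_empty by simp

lemma outer_Un: "outer (A \<union> B) \<le> outer A + outer B"
proof -
  have "outer (A \<union> B) = outer (\<Union>i. binaryset A B i)"
    by (simp add: UN_binaryset_eq)
  also have "\<dots> \<le> (\<Sum>i. outer (binaryset A B i))" by (rule outer_UN)
  also have "\<dots> = outer A + outer B"
    by (rule suminf_binaryset_eq) (rule outer_empty)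
  finally show ?thesis .
qed

text \<open>The nontrivial half of Caratheodory's criterion for an open test set \<open>W\<close>. A
  truncated competitor for \<open>W \<inter> U\<close> and a competitor for an open set around
  \<open>W - U\<close> are never nonzero at the same point, so their sum is still bounded by 1 and
  competes for \<open>W\<close>.\<close>

lemma content_split:
  assumes "open U" "open W"
  shows "content (W \<inter> U) + outer (W - U) \<le> content W"
proof -
  have "ennreal (L f) + outer (W - U) \<le> content W" if f: "f \<in> below (W \<inter> U)" for f
  proof (rule ennreal_le_epsilon)
    fix e :: real assume e: "0 < e"
    define h where "h x = max (f x - e) 0" for x
    note t = truncate[OF f e, folded h_def]
    \<comment> \<open>Since \<open>f\<close> vanishes off \<open>U\<close>, this open set contains
      \<open>W - U\<close>; since \<open>h\<close> vanishes where \<open>f x < e\<close>, it avoids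
      the points where \<open>h\<close> is positive.\<close>
    define W' where "W' = W \<inter> {x. f x < e}"
    have W': "open W'" unfolding W'_def using t(5) assms by blast
    have "W - U \<subseteq> W'" using belowD(4)[OF f] e by (auto simp: W'_def)
    have "ennreal (L f) + ennreal (L g) \<le> content W + ennreal e" if g: "g \<in> below W'" for g
    proof -
      have hg: "(\<lambda>x. h x + g x) \<in> below W"
      proof (rule belowI)
        show "continuous_on UNIV (\<lambda>x. h x + g x)"
          by (intro continuous_intros belowD[OF g] belowD[OF t(1)])
        fix x
        show "0 \<le> h x + g x" using belowD(2)[OF g] belowD(2)[OF t(1)] by simp
        show "h x + g x \<le> 1"
          using belowD(3,4)[OF g, of x] belowD(3)[OF t(1), of x]
          by (cases "f x < e") (auto simp: W'_def h_def)
        show "h x + g x = 0" if "x \<notin> W"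
          using belowD(4)[OF g, of x] belowD(4)[OF t(1), of x] that by (simp add: W'_def)
      qed
      have "L (\<lambda>x. h x + g x) = L h + L g"
        by (rule add[OF belowD(1)[OF t(1)] belowD(1)[OF g]])
      then have "L f + L g \<le> L (\<lambda>x. h x + g x) + e" using t(2) by simp
      then have "ennreal (L f + L g) \<le> ennreal (L (\<lambda>x. h x + g x) + e)"
        by (rule ennreal_leI)
      also have "\<dots> = ennreal (L (\<lambda>x. h x + g x)) + ennreal e"
        using belowD(5)[OF hg] e by (simp add: ennreal_plus)
      also have "\<dots> \<le> content W + ennreal e"
        by (intro add_mono L_le_content hg order_refl)
      finally show ?thesis
        using belowD(5)[OF f] belowD(5)[OF g] by (simp add: ennreal_plus)
    qed
    then have "ennreal (L f) + content W' \<le> content W + ennreal e"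
      unfolding content_def[of W'] using zero_in_below[of W']
      by (subst ennreal_SUP_add_right) (auto intro!: SUP_least)
    moreover have "outer (W - U) \<le> content W'"
      using outer_mono[OF \<open>W - U \<subseteq> W'\<close>] outer_open[OF W'] by simp
    ultimately show "ennreal (L f) + outer (W - U) \<le> content W + ennreal e"
      by (meson add_left_mono order_trans)
  qed
  then show ?thesis
    unfolding content_def[of "W \<inter> U"] using zero_in_below[of "W \<inter> U"]
    by (subst ennreal_SUP_add_left[symmetric]) (auto intro!: SUP_least)
qed

lemma outer_measure_space_outer: "outer_measure_space (Pow UNIV) outer"
  unfolding outer_measure_space_def positive_def increasing_def countably_subadditive_def
  by (auto intro: outer_empty outer_mono outer_UN)

text \<open>An arbitrary test set is replaced by an open superset \<open>W\<close> of nearly the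
  same outer measure, to which \<open>content_split\<close> applies.\<close>

lemma open_in_lambda_system:
  assumes "open U"
  shows "U \<in> lambda_system UNIV (Pow UNIV) outer"
  unfolding algebra.lambda_system_eq[OF algebra_Pow]
proof (clarsimp, rule antisym)
  fix A
  show "outer (A \<inter> U) + outer (A - U) \<le> outer A"
    unfolding outer_def[of A]
  proof (rule INF_greatest, clarify)
    fix W assume W: "open W" "A \<subseteq> W"
    have "outer (A \<inter> U) + outer (A - U) \<le> outer (W \<inter> U) + outer (W - U)"
      using W by (intro add_mono outer_mono) auto
    also have "\<dots> \<le> content W"
      using content_split[OF assms W(1)] outer_open[of "W \<inter> U"] assms W by (simp add: open_Int)
    finally show "outer (A \<inter> U) + outer (A - U) \<le> content W" .
  qed
  show "outer A \<le> outer (A \<inter> U) + outer (A - U)"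
    using outer_Un[of "A \<inter> U" "A - U"] by (simp add: Int_Diff_Un)
qed

section \<open>The representing measure and its regularity\<close>

definition representing_measure :: "'b measure" where
  "representing_measure = measure_of UNIV (sets borel) outer"

lemma sets_representing: "sets representing_measure = sets borel"
  unfolding representing_measure_def by (metis sets.sets_measure_of_eq space_borel)

text \<open>Caratheodory's lemma makes \<open>outer\<close> countably additive on its measurable
  sets. These form a sigma-algebra containing the open sets, hence all Borel sets, to which the
  measure is restricted.\<close>

lemma emeasure_representing:
  assumes "A \<in> sets borel"
  shows "emeasure representing_measure A = outer A"
proof -
  have ls: "measure_space UNIV (lambda_system UNIV (Pow UNIV) outer) outer"
    by (rule sigma_algebra.caratheodory_lemma[OF sigma_algebra_Pow outer_measure_space_outer])
  then interpret ls: sigma_algebra UNIV "lambda_system UNIV (Pow UNIV) outer"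
    by (simp add: measure_space_def)
  have "sets borel \<subseteq> lambda_system UNIV (Pow UNIV) outer"
    unfolding sets_borel by (rule ls.sigma_sets_subset) (use open_in_lambda_system in blast)
  then have "measure_space UNIV (sets borel) outer"
    using measure_down[OF ls] sets.sigma_algebra_axioms[of borel] by simp
  then show ?thesis
    unfolding representing_measure_def
    using assms sets.sigma_algebra_axioms[of borel]
    by (intro emeasure_measure_of_sigma) (auto simp: measure_space_def)
qed

lemma prob_space_representing: "prob_space representing_measure"
proof
  have "ennreal 1 \<le> content UNIV"
    using L_le_content[OF belowI, of "\<lambda>_. 1" UNIV] one by simp
  then have "outer UNIV = 1"
    using content_le_one[of UNIV] outer_open[of UNIV] by (intro antisym) simp_all
  moreover have "space representing_measure = UNIV"
    using sets_eq_imp_space_eq[OF sets_representing] by simp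
  ultimately show "emeasure representing_measure (space representing_measure) = 1"
    by (simp add: emeasure_representing)
qed

lemma outer_regular_representing:
  assumes "A \<in> sets borel"
  shows "emeasure representing_measure A
           = (INF U\<in>{U. A \<subseteq> U \<and> open U}. emeasure representing_measure U)"
proof -
  have "(INF U\<in>{U. A \<subseteq> U \<and> open U}. emeasure representing_measure U)
          = (INF U\<in>{U. open U \<and> A \<subseteq> U}. content U)"
    by (rule INF_cong) (auto simp: emeasure_representing outer_open)
  then show ?thesis using assms by (simp add: emeasure_representing outer_def)
qed

text \<open>Outer regularity is built into \<open>outer\<close>. Inner regularity follows by passing
  to complements: an open \<open>U\<close> slightly larger than \<open>- A\<close> has a compact
  complement inside \<open>A\<close>, and finiteness of the measure turns the small excess of
  \<open>U\<close> into a small defect of \<open>- U\<close>.\<close>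

lemma regular_representing: "regular_measure representing_measure"
  unfolding regular_measure_def
proof (intro ballI conjI outer_regular_representing)
  interpret P: prob_space representing_measure by (rule prob_space_representing)
  let ?P = representing_measure
  have sp: "space ?P = UNIV"
    using sets_eq_imp_space_eq[OF sets_representing] by simp
  fix A assume "A \<in> sets ?P"
  then have A: "A \<in> sets borel" by (simp add: sets_representing)
  then show "A \<in> sets borel" .
  show "emeasure ?P A = (SUP K\<in>{K. K \<subseteq> A \<and> compact K}. emeasure ?P K)"
  proof (rule antisym)
    show "emeasure ?P A \<le> (SUP K\<in>{K. K \<subseteq> A \<and> compact K}. emeasure ?P K)"
    proof (rule ennreal_le_epsilon)
      fix e :: real assume e: "0 < e"
      have cA: "- A \<in> sets borel" using A by auto
      have "emeasure ?P (- A) < emeasure ?P (- A) + ennreal e"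
        using e by (simp add: P.emeasure_eq_measure ennreal_less_iff flip: ennreal_plus)
      then obtain U where U: "- A \<subseteq> U" "open U" "emeasure ?P U < emeasure ?P (- A) + ennreal e"
        unfolding outer_regular_representing[OF cA] INF_less_iff by auto
      have "compact (- U)"
        using compact_Int_closed[OF compact_UNIV, of "- U"] U(2) by (simp add: closed_Compl)
      have "P.prob U < P.prob (- A) + e"
        using U(3) e by (simp add: P.emeasure_eq_measure ennreal_less_iff flip: ennreal_plus)
      moreover have "P.prob (- U) = 1 - P.prob U" "P.prob (- A) = 1 - P.prob A"
        using P.prob_compl[of U] P.prob_compl[of A] U(2) A
        by (auto simp: sets_representing sp Compl_eq_Diff_UNIV)
      ultimately have "emeasure ?P A \<le> emeasure ?P (- U) + ennreal e"
        using e by (simp add: P.emeasure_eq_measure flip: ennreal_plus)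
      also have "\<dots> \<le> (SUP K\<in>{K. K \<subseteq> A \<and> compact K}. emeasure ?P K) + ennreal e"
        using U(1) \<open>compact (- U)\<close> by (intro add_mono SUP_upper order_refl) auto
      finally show "emeasure ?P A \<le> (SUP K\<in>{K. K \<subseteq> A \<and> compact K}. emeasure ?P K) + ennreal e" .
    qed
    show "(SUP K\<in>{K. K \<subseteq> A \<and> compact K}. emeasure ?P K) \<le> emeasure ?P A"
      using A by (intro SUP_least emeasure_mono) (auto simp: sets_representing)
  qed
qed

section \<open>Integrals of continuous functions\<close>

lemma integrable_representing:
  "continuous_on UNIV f \<Longrightarrow> integrable representing_measure (f :: 'b \<Rightarrow> real)"
  by (rule integrable_continuous_compact[OF compact_UNIV prob_space_representing sets_representing])

text \<open>Layer cake: \<open>n * L (min f ((i+1)/n) - min f (i/n))\<close> is at most the measure of \<open>{f > i/n}\<close>.\<close>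

lemma L_le_integral:
  assumes f: "continuous_on UNIV f" "\<And>x. 0 \<le> f x" "\<And>x. f x \<le> 1"
  shows "L f \<le> (\<integral>x. f x \<partial>representing_measure)"
proof (rule field_le_epsilon)
  let ?P = representing_measure
  interpret P: prob_space ?P by (rule prob_space_representing)
  fix e :: real assume "0 < e"
  then obtain n where n: "inverse (real (Suc n)) < e" using reals_Archimedean by blast
  define N where "N = real (Suc n)"
  have N: "0 < N" "1 / N < e" using n by (auto simp: N_def inverse_eq_divide)
  define s where "s i x = min (f x) (real (Suc i) / N) - min (f x) (real i / N)" for i x
  define U where "U i = {x. real i / N < f x}" for i
  have oU: "open (U i)" for i
    unfolding U_def by (intro open_Collect_less f continuous_intros)
  have step: "real (Suc i) / N = real i / N + 1 / N" for i
    by (simp add: add_divide_distrib)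
  have s: "continuous_on UNIV (s i)" for i
    unfolding s_def by (intro continuous_intros f)
  have Ls: "L (s i) \<le> P.prob (U i) / N" for i
  proof -
    have "0 \<le> min a (b + d) - min a b \<and> min a (b + d) - min a b \<le> d
        \<and> (\<not> b < a \<longrightarrow> min a (b + d) - min a b = 0)" if "0 < d" for a b d :: real
      using that by (auto simp: min_def)
    from this[of "1 / N" "f _" "real i / N"] N(1)
    have sb: "0 \<le> s i x" "s i x \<le> 1 / N" "x \<notin> U i \<Longrightarrow> s i x = 0" for x
      unfolding s_def U_def step by auto
    have "(\<lambda>x. N * s i x) \<in> below (U i)"
    proof (rule belowI)
      fix x show "N * s i x \<le> 1" using sb(2)[of x] N by (simp add: field_simps)
    qed (use sb N in \<open>auto intro!: continuous_intros s\<close>)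
    from L_le_content[OF this] have "ennreal (N * L (s i)) \<le> ennreal (P.prob (U i))"
      using emeasure_representing[of "U i"] oU
      by (simp add: scale s outer_open P.emeasure_eq_measure)
    then show ?thesis using N by (simp add: field_simps)
  qed
  \<comment> \<open>The sum telescopes from \<open>min (f x) 0 = 0\<close> to
    \<open>min (f x) 1 = f x\<close>; this is where \<open>0 \<le> f x \<le> 1\<close>
    enters.\<close>
  have "f x = (\<Sum>i<Suc n. s i x)" for x
    unfolding s_def using sum_lessThan_telescope[of "\<lambda>i. min (f x) (real i / N)" "Suc n"] f(2,3)[of x]
    by (simp add: N_def)
  then have "L f = L (\<lambda>x. \<Sum>i<Suc n. s i x)" by presburger
  also have "\<dots> = (\<Sum>i<Suc n. L (s i))" by (intro sum s)
  also have "\<dots> \<le> (\<Sum>i<Suc n. P.prob (U i) / N)" by (intro sum_mono Ls)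
  also have "\<dots> = (\<Sum>i<Suc n. \<integral>x. indicator (U i) x / N \<partial>?P)"
    using oU by (intro sum.cong) (auto simp: sets_representing)
  also have "\<dots> = (\<integral>x. (\<Sum>i<Suc n. indicator (U i) x / N) \<partial>?P)"
    using oU by (subst Bochner_Integration.integral_sum) (auto simp: sets_representing P.emeasure_eq_measure)
  also have "\<dots> \<le> (\<integral>x. f x + 1 / N \<partial>?P)"
  proof (rule integral_mono)
    show "integrable ?P (\<lambda>x. \<Sum>i<Suc n. indicator (U i) x / N)"
      using oU by (intro Bochner_Integration.integrable_sum) (auto simp: sets_representing P.emeasure_eq_measure)
    show "integrable ?P (\<lambda>x. f x + 1 / N)"
      by (intro integrable_representing continuous_intros f)
    fix x
    \<comment> \<open>Counting the levels \<open>i / N\<close> below \<open>f x\<close> overshoots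
      \<open>f x\<close> by at most one level. The minimum with \<open>real m / N\<close> is the
      strengthening that lets the induction pass.\<close>
    have "(\<Sum>i<m. indicator (U i) x / N) \<le> min (f x) (real m / N) + 1 / N" for m
    proof (induction m)
      case 0
      then show ?case using f(2)[of x] N by simp
    next
      case (Suc m)
      have "(\<Sum>i<Suc m. indicator (U i) x / N) \<le> (\<Sum>i<Suc m. 1 / N)"
        using N by (intro sum_mono divide_right_mono) (auto simp: indicator_def)
      then have le: "(\<Sum>i<Suc m. indicator (U i) x / N) \<le> real (Suc m) / N" by simp
      have grow: "real m / N \<le> real (Suc m) / N"
        using N by (intro divide_right_mono) auto
      show ?case
      proof (cases "x \<in> U m")
        case True
        then have "real m / N \<le> min (f x) (real (Suc m) / N)" using grow by (simp add: U_def)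
        then show ?thesis using le step[of m] by linarith
      next
        case False
        then have "(\<Sum>i<Suc m. indicator (U i) x / N) = (\<Sum>i<m. indicator (U i) x / N)" by simp
        also have "\<dots> \<le> min (f x) (real m / N) + 1 / N" by (rule Suc)
        also have "\<dots> \<le> min (f x) (real (Suc m) / N) + 1 / N"
          by (intro add_right_mono min.mono order_refl grow)
        finally show ?thesis .
      qed
    qed
    from this[of "Suc n"] show "(\<Sum>i<Suc n. indicator (U i) x / N) \<le> f x + 1 / N"
      by linarith
  qed
  also have "\<dots> = (\<integral>x. f x \<partial>?P) + 1 / N"
    by (simp add: integrable_representing f P.prob_space)
  also have "\<dots> \<le> (\<integral>x. f x \<partial>?P) + e" using N by simp
  finally show "L f \<le> (\<integral>x. f x \<partial>?P) + e" .
qed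

text \<open>The one-sided estimate, applied to both \<open>f\<close> and \<open>1 - f\<close>, gives
  equality for functions with values in the unit interval. The general case follows by an affine
  change.\<close>

lemma integral_representing:
  assumes "continuous_on UNIV f"
  shows "(\<integral>x. f x \<partial>representing_measure) = L f"
proof -
  let ?P = representing_measure
  interpret P: prob_space ?P by (rule prob_space_representing)
  have unit: "(\<integral>x. f x \<partial>?P) = L f"
    if f: "continuous_on UNIV f" "\<And>x. 0 \<le> f x" "\<And>x. f x \<le> 1" for f :: "'b \<Rightarrow> real"
  proof (rule antisym)
    show "L f \<le> (\<integral>x. f x \<partial>?P)" by (rule L_le_integral[OF f])
    have "L (\<lambda>x. 1 - f x) \<le> (\<integral>x. 1 - f x \<partial>?P)"
      using f by (intro L_le_integral continuous_intros) auto
    then show "(\<integral>x. f x \<partial>?P) \<le> L f"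
      using diff[of "\<lambda>_. 1" f] f(1) by (simp add: one integrable_representing P.prob_space)
  qed
  have "bounded (range f)"
    using compact_continuous_image[OF assms compact_UNIV] by (rule compact_imp_bounded)
  then obtain C where C: "0 < C" "\<And>x. \<bar>f x\<bar> \<le> C" by (auto simp: bounded_pos)
  \<comment> \<open>Maps the range \<open>[-C, C]\<close> into \<open>[0, 1]\<close>.\<close>
  define g where "g x = 1/2 + 1 / (2 * C) * f x" for x
  have cg: "continuous_on UNIV g" unfolding g_def by (intro continuous_intros assms)
  have "0 \<le> g x \<and> g x \<le> 1" for x
    using C(1) C(2)[of x] by (auto simp: g_def field_simps abs_le_iff)
  with cg have "(\<integral>x. g x \<partial>?P) = L g" by (intro unit) auto
  moreover have "(\<integral>x. g x \<partial>?P) = 1/2 + 1 / (2 * C) * (\<integral>x. f x \<partial>?P)"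
    unfolding g_def by (simp add: integrable_representing assms P.prob_space)
  moreover have "L g = 1/2 + 1 / (2 * C) * L f"
    unfolding g_def using add[OF continuous_on_const continuous_on_mult_left[OF assms]]
    by (simp only: const scale[OF assms])
  ultimately show ?thesis using C(1) by simp
qed

theorem Riesz_Markov:
  "\<exists>P. regular_borel_prob P \<and> (\<forall>f. continuous_on UNIV f \<longrightarrow> (\<integral>x. f x \<partial>P) = L f)"
  using sets_representing prob_space_representing regular_representing integral_representing
  unfolding regular_borel_prob_def by blast

end

text \<open>Inner regularity settles open sets: a Urysohn function between \<open>K\<close> and
  \<open>U\<close> squeezes \<open>P K\<close> under \<open>Q U\<close>. Outer regularity then
  passes from open sets to all Borel sets.\<close>

lemma regular_borel_prob_eqI:
  fixes P Q :: "'b::t2_space measure"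
  assumes "compact (UNIV :: 'b set)" and P: "regular_borel_prob P" and Q: "regular_borel_prob Q"
    and eq: "\<And>f :: 'b \<Rightarrow> real. continuous_on UNIV f \<Longrightarrow> (\<integral>x. f x \<partial>P) = (\<integral>x. f x \<partial>Q)"
  shows "P = Q"
proof -
  \<comment> \<open>Stated for fresh \<open>P\<close> and \<open>Q\<close>, so that it can be used
    in both orders.\<close>
  have le: "emeasure P U \<le> emeasure Q U"
    if P: "regular_borel_prob P" and Q: "regular_borel_prob Q" and U: "open U"
      and eq: "\<And>f :: 'b \<Rightarrow> real. continuous_on UNIV f \<Longrightarrow> (\<integral>x. f x \<partial>P) = (\<integral>x. f x \<partial>Q)"
    for P Q :: "'b measure" and U
  proof -
    have sP: "sets P = sets borel" and sQ: "sets Q = sets borel"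
      and P': "prob_space P" and Q': "prob_space Q"
      using P Q by (auto simp: regular_borel_prob_def)
    interpret P: prob_space P by (rule P')
    interpret Q: prob_space Q by (rule Q')
    have "emeasure P U = (SUP K\<in>{K. K \<subseteq> U \<and> compact K}. emeasure P K)"
      using P U by (auto simp: regular_borel_prob_def regular_measure_def)
    also have "\<dots> \<le> emeasure Q U"
    proof (rule SUP_least, clarify)
      fix K assume K: "K \<subseteq> U" "compact K"
      have "closed (- U)" "closed K" "- U \<inter> K = {}"
        using K U by (auto intro: compact_imp_closed)
      then obtain f :: "'b \<Rightarrow> real" where f: "continuous_on UNIV f" "\<And>x. 0 \<le> f x" "\<And>x. f x \<le> 1"
          "\<And>x. x \<in> - U \<Longrightarrow> f x = 0" "\<And>x. x \<in> K \<Longrightarrow> f x = 1"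
        using Urysohn_compact_t2[OF assms(1)] by blast
      have int: "integrable P f" "integrable Q f" "integrable P (indicator K :: _ \<Rightarrow> real)"
          "integrable Q (indicator U :: _ \<Rightarrow> real)"
        using f(1) assms(1) P' Q' sP sQ U \<open>closed K\<close>
        by (auto intro: integrable_continuous_compact simp: P.emeasure_eq_measure Q.emeasure_eq_measure)
      have "P.prob K = (\<integral>x. indicator K x \<partial>P)"
        using \<open>closed K\<close> sP by simp
      also have "\<dots> \<le> (\<integral>x. f x \<partial>P)"
        by (intro integral_mono int) (use f in \<open>auto simp: indicator_def\<close>)
      also have "\<dots> = (\<integral>x. f x \<partial>Q)" by (rule eq[OF f(1)])
      also have "\<dots> \<le> (\<integral>x. indicator U x \<partial>Q)"
        by (intro integral_mono int) (use f in \<open>auto simp: indicator_def\<close>)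
      also have "\<dots> = Q.prob U" using U sQ by simp
      finally show "emeasure P K \<le> emeasure Q U"
        by (simp add: P.emeasure_eq_measure Q.emeasure_eq_measure)
    qed
    finally show ?thesis .
  qed
  have opens: "emeasure P U = emeasure Q U" if "open U" for U
    using le[OF P Q that eq] le[OF Q P that eq[symmetric]] by (rule antisym)
  have sets: "sets P = sets borel" "sets Q = sets borel"
    using P Q by (auto simp: regular_borel_prob_def)
  show "P = Q"
  proof (rule measure_eqI)
    fix A assume A: "A \<in> sets P"
    have "emeasure P A = (INF U\<in>{U. A \<subseteq> U \<and> open U}. emeasure P U)"
      using P A unfolding regular_borel_prob_def regular_measure_def by blast
    also have "\<dots> = (INF U\<in>{U. A \<subseteq> U \<and> open U}. emeasure Q U)"
      by (rule INF_cong) (auto simp: opens)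
    also have "\<dots> = emeasure Q A"
      using Q A unfolding sets unfolding regular_borel_prob_def regular_measure_def by metis
    finally show "emeasure P A = emeasure Q A" .
  qed (simp add: sets)
qed

section \<open>Linear combinations of tensors\<close>

lemma tensor_Nil: "tensor [] \<omega> = 1"
  by (simp add: tensor_def)

lemma tensor_Cons: "tensor (\<phi> # \<phi>s) \<omega> = \<phi> (\<omega> 0) * tensor \<phi>s (\<lambda>i. \<omega> (Suc i))"
  by (simp add: tensor_def prod.lessThan_Suc_shift del: prod.lessThan_Suc)

lemma continuous_on_tensor:
  assumes "set \<phi>s \<subseteq> C_space"
  shows "continuous_on UNIV (tensor \<phi>s)"
proof -
  have "continuous_on UNIV (\<lambda>\<omega>. (\<phi>s ! i) (\<omega> i))" if "i < length \<phi>s" for i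
  proof (rule continuous_on_compose2[of UNIV "\<phi>s ! i" UNIV "\<lambda>\<omega>. \<omega> i"])
    show "continuous_on UNIV (\<phi>s ! i)"
      using nth_mem[OF that] assms by (auto simp: C_space_def)
  qed auto
  then show ?thesis unfolding tensor_def by (intro continuous_on_prod) auto
qed

text \<open>A product of two tensors is again a single tensor. The surplus entries of the longer
  list are kept, since the missing factors of the shorter one are constantly 1.\<close>

fun pointwise_mult :: "('a \<Rightarrow> real) list \<Rightarrow> ('a \<Rightarrow> real) list \<Rightarrow> ('a \<Rightarrow> real) list" where
  "pointwise_mult [] \<psi>s = \<psi>s"
| "pointwise_mult \<phi>s [] = \<phi>s"
| "pointwise_mult (\<phi> # \<phi>s) (\<psi> # \<psi>s) = (\<lambda>y. \<phi> y * \<psi> y) # pointwise_mult \<phi>s \<psi>s"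

lemma tensor_pointwise_mult:
  "tensor (pointwise_mult \<phi>s \<psi>s) \<omega> = tensor \<phi>s \<omega> * tensor \<psi>s \<omega>"
  by (induction \<phi>s \<psi>s arbitrary: \<omega> rule: pointwise_mult.induct) (auto simp: tensor_Nil tensor_Cons)

lemma C_space_mult: "\<phi> \<in> C_space \<Longrightarrow> \<psi> \<in> C_space \<Longrightarrow> (\<lambda>y. \<phi> y * \<psi> y) \<in> C_space"
  by (auto simp: C_space_def intro: continuous_intros)

lemma set_pointwise_mult:
  "set \<phi>s \<subseteq> C_space \<Longrightarrow> set \<psi>s \<subseteq> C_space \<Longrightarrow> set (pointwise_mult \<phi>s \<psi>s) \<subseteq> C_space"
  by (induction \<phi>s \<psi>s rule: pointwise_mult.induct) (auto simp: C_space_mult)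

lemma const_in_C_space: "(\<lambda>_. c) \<in> C_space"
  by (simp add: C_space_def)

text \<open>A list of pairs \<open>(c, \<phi>s)\<close> is a code for the linear combination of the \<open>tensor \<phi>s\<close> with
  coefficients \<open>c\<close>.\<close>

definition tensor_sum :: "(real \<times> ('a \<Rightarrow> real) list) list \<Rightarrow> (nat \<Rightarrow> 'a) \<Rightarrow> real" where
  "tensor_sum ps \<omega> = (\<Sum>p\<leftarrow>ps. fst p * tensor (snd p) \<omega>)"

definition continuous_code :: "(real \<times> ('a::topological_space \<Rightarrow> real) list) list \<Rightarrow> bool" where
  "continuous_code ps \<longleftrightarrow> (\<forall>p\<in>set ps. set (snd p) \<subseteq> C_space)"

lemma continuous_code_simps:
  "continuous_code []"
  "continuous_code (p # ps) \<longleftrightarrow> set (snd p) \<subseteq> C_space \<and> continuous_code ps"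
  "continuous_code (ps @ qs) \<longleftrightarrow> continuous_code ps \<and> continuous_code qs"
  by (auto simp: continuous_code_def)

lemma tensor_sum_simps:
  "tensor_sum [] \<omega> = 0"
  "tensor_sum (p # ps) \<omega> = fst p * tensor (snd p) \<omega> + tensor_sum ps \<omega>"
  "tensor_sum (ps @ qs) \<omega> = tensor_sum ps \<omega> + tensor_sum qs \<omega>"
  by (auto simp: tensor_sum_def)

lemma continuous_on_tensor_sum: "continuous_code ps \<Longrightarrow> continuous_on UNIV (tensor_sum ps)"
  by (induction ps)
    (auto simp: tensor_sum_simps continuous_code_simps intro!: continuous_intros continuous_on_tensor)

lemma continuous_code_scale:
  "continuous_code ps \<Longrightarrow> continuous_code (map (\<lambda>p. (c * fst p, snd p)) ps)"
  by (simp add: continuous_code_def)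

lemma tensor_sum_scale: "tensor_sum (map (\<lambda>p. (c * fst p, snd p)) ps) \<omega> = c * tensor_sum ps \<omega>"
  by (induction ps) (auto simp: tensor_sum_simps algebra_simps)

lemma tensor_sum_mult:
  assumes "continuous_code ps" "continuous_code qs"
  shows "\<exists>rs. continuous_code rs \<and> (\<forall>\<omega>. tensor_sum rs \<omega> = tensor_sum ps \<omega> * tensor_sum qs \<omega>)"
  using assms(1)
proof (induction ps)
  case Nil
  then show ?case by (intro exI[of _ "[]"]) (simp add: tensor_sum_simps continuous_code_simps)
next
  case (Cons p ps)
  then obtain rs where rs: "continuous_code rs"
      "\<And>\<omega>. tensor_sum rs \<omega> = tensor_sum ps \<omega> * tensor_sum qs \<omega>"
    by (auto simp: continuous_code_simps)
  define ts where "ts = map (\<lambda>q. (fst p * fst q, pointwise_mult (snd p) (snd q))) qs"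
  have "set (pointwise_mult (snd p) (snd q)) \<subseteq> C_space" if "q \<in> set qs" for q
    using Cons.prems assms(2) that by (intro set_pointwise_mult) (auto simp: continuous_code_def)
  then have "continuous_code ts" by (auto simp: ts_def continuous_code_def)
  moreover have "tensor_sum ts \<omega> = fst p * tensor (snd p) \<omega> * tensor_sum qs \<omega>" for \<omega>
    unfolding ts_def by (induction qs) (auto simp: tensor_sum_simps tensor_pointwise_mult algebra_simps)
  ultimately show ?case
    using rs by (intro exI[of _ "ts @ rs"])
      (simp add: tensor_sum_simps continuous_code_simps algebra_simps)
qed

text \<open>Padding with the constant 1 makes a function of any single coordinate a tensor. This is
  what separates points in the Stone--Weierstrass argument.\<close>

lemma tensor_coordinate: "tensor (replicate i (\<lambda>_. 1) @ [\<phi>]) \<omega> = \<phi> (\<omega> i)"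
  by (induction i arbitrary: \<omega>) (auto simp: tensor_Cons tensor_Nil)

lemma tensor_sum_dense:
  fixes f :: "(nat \<Rightarrow> 'a::t2_space) \<Rightarrow> real"
  assumes compact: "compact (UNIV :: 'a set)" and f: "continuous_on UNIV f" and e: "0 < e"
  obtains ps where "continuous_code ps" "\<And>\<omega>. \<bar>f \<omega> - tensor_sum ps \<omega>\<bar> < e"
proof -
  let ?A = "\<lambda>g. \<exists>ps. continuous_code ps \<and> (\<forall>\<omega>. g \<omega> = tensor_sum ps \<omega>)"
  have "\<exists>g. ?A g \<and> (\<forall>\<omega>\<in>UNIV. \<bar>f \<omega> - g \<omega>\<bar> < e)"
  proof (rule Stone_Weierstrass_HOL[OF _ _ _ _ _ _ f e])
    show "compact (UNIV :: (nat \<Rightarrow> 'a) set)" by (rule compact_UNIV_fun[OF compact])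
    show "?A (\<lambda>_. c)" for c
      by (rule exI[of _ "[(c, [])]"]) (simp add: tensor_sum_simps continuous_code_simps tensor_Nil)
    show "continuous_on UNIV g" if "?A g" for g
    proof -
      from that obtain ps where "continuous_code ps" "g = tensor_sum ps" by auto
      then show ?thesis using continuous_on_tensor_sum by blast
    qed
    show "?A (\<lambda>\<omega>. g \<omega> + h \<omega>)" if "?A g \<and> ?A h" for g h
    proof -
      from that obtain ps qs where "continuous_code ps" "continuous_code qs"
        "\<forall>\<omega>. g \<omega> = tensor_sum ps \<omega>" "\<forall>\<omega>. h \<omega> = tensor_sum qs \<omega>" by blast
      then show ?thesis
        by (intro exI[of _ "ps @ qs"]) (simp add: tensor_sum_simps continuous_code_simps)
    qed
    show "?A (\<lambda>\<omega>. g \<omega> * h \<omega>)" if "?A g \<and> ?A h" for g h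
    proof -
      from that obtain ps qs where "continuous_code ps" "continuous_code qs"
        "\<forall>\<omega>. g \<omega> = tensor_sum ps \<omega>" "\<forall>\<omega>. h \<omega> = tensor_sum qs \<omega>" by blast
      then show ?thesis using tensor_sum_mult[of ps qs] by metis
    qed
    show "\<exists>g. ?A g \<and> g \<omega> \<noteq> g \<omega>'" if "\<omega> \<in> UNIV \<and> \<omega>' \<in> UNIV \<and> \<omega> \<noteq> \<omega>'" for \<omega> \<omega>' :: "nat \<Rightarrow> 'a"
    proof -
      from that obtain i where "\<omega> i \<noteq> \<omega>' i" by auto
      then have "{\<omega> i} \<inter> {\<omega>' i} = {}" by auto
      from Urysohn_compact_t2[OF compact closed_singleton closed_singleton this]
      obtain \<phi> :: "'a \<Rightarrow> real" where \<phi>: "continuous_on UNIV \<phi>" "\<phi> (\<omega> i) = 0" "\<phi> (\<omega>' i) = 1"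
        by (metis singletonI)
      let ?ps = "[(1, replicate i (\<lambda>_. 1) @ [\<phi>])]"
      have "continuous_code ?ps"
        using \<phi>(1) const_in_C_space[of 1]
        by (auto simp: continuous_code_simps C_space_def split: if_splits)
      moreover have "tensor_sum ?ps \<omega> \<noteq> tensor_sum ?ps \<omega>'"
        using \<phi> by (simp add: tensor_sum_simps tensor_coordinate)
      ultimately show ?thesis by blast
    qed
  qed
  then show ?thesis using that by force
qed

text \<open>Agreement extends linearly to all tensor combinations. Approximating \<open>f\<close>
  uniformly within \<open>e/2\<close> changes each of the two integrals by at most
  \<open>e/2\<close>, as both measures have mass 1.\<close>

lemma regular_borel_prob_eqI_tensor:
  fixes P Q :: "(nat \<Rightarrow> 'a::t2_space) measure"
  assumes compact: "compact (UNIV :: 'a set)"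
    and P: "regular_borel_prob P" and Q: "regular_borel_prob Q"
    and eq: "\<And>\<phi>s. \<phi>s \<noteq> [] \<Longrightarrow> set \<phi>s \<subseteq> C_space \<Longrightarrow> (\<integral>\<omega>. tensor \<phi>s \<omega> \<partial>P) = (\<integral>\<omega>. tensor \<phi>s \<omega> \<partial>Q)"
  shows "P = Q"
proof (rule regular_borel_prob_eqI[OF compact_UNIV_fun[OF compact] P Q])
  have sets: "sets P = sets borel" "sets Q = sets borel" and P': "prob_space P" and Q': "prob_space Q"
    using P Q by (auto simp: regular_borel_prob_def)
  interpret P: prob_space P by (rule P')
  interpret Q: prob_space Q by (rule Q')
  have int: "integrable P f" "integrable Q f" if "continuous_on UNIV f" for f :: "_ \<Rightarrow> real"
    using that sets P' Q' compact_UNIV_fun[OF compact] by (auto intro: integrable_continuous_compact)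
  \<comment> \<open>The empty list is not covered by \<open>eq\<close>, but its tensor is the
    constant 1, whose integral is the total mass.\<close>
  have tens: "(\<integral>\<omega>. tensor \<phi>s \<omega> \<partial>P) = (\<integral>\<omega>. tensor \<phi>s \<omega> \<partial>Q)" if "set \<phi>s \<subseteq> C_space" for \<phi>s
    using eq[OF _ that] by (cases "\<phi>s = []") (auto simp: tensor_Nil P.prob_space Q.prob_space)
  have sums: "(\<integral>\<omega>. tensor_sum ps \<omega> \<partial>P) = (\<integral>\<omega>. tensor_sum ps \<omega> \<partial>Q)" if "continuous_code ps" for ps
    using that
  proof (induction ps)
    case (Cons p ps)
    then show ?case
      by (simp add: tensor_sum_simps(2)[abs_def] continuous_code_simps int continuous_on_tensor
          continuous_on_tensor_sum tens)
  qed (simp add: tensor_sum_simps(1)[abs_def])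
  fix f :: "(nat \<Rightarrow> 'a) \<Rightarrow> real" assume f: "continuous_on UNIV f"
  have "\<bar>(\<integral>\<omega>. f \<omega> \<partial>P) - (\<integral>\<omega>. f \<omega> \<partial>Q)\<bar> \<le> 0 + e" if e: "0 < e" for e
  proof -
    obtain ps where ps: "continuous_code ps" "\<And>\<omega>. \<bar>f \<omega> - tensor_sum ps \<omega>\<bar> < e/2"
      using tensor_sum_dense[OF compact f half_gt_zero[OF e]] by blast
    note c = continuous_on_tensor_sum[OF ps(1)]
    have bd: "tensor_sum ps \<omega> - e/2 \<le> f \<omega>" "f \<omega> \<le> tensor_sum ps \<omega> + e/2" for \<omega>
      using ps(2)[of \<omega>] by linarith+
    have "(\<integral>\<omega>. f \<omega> \<partial>P) \<le> (\<integral>\<omega>. tensor_sum ps \<omega> + e/2 \<partial>P)"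
         "(\<integral>\<omega>. tensor_sum ps \<omega> - e/2 \<partial>P) \<le> (\<integral>\<omega>. f \<omega> \<partial>P)"
         "(\<integral>\<omega>. f \<omega> \<partial>Q) \<le> (\<integral>\<omega>. tensor_sum ps \<omega> + e/2 \<partial>Q)"
         "(\<integral>\<omega>. tensor_sum ps \<omega> - e/2 \<partial>Q) \<le> (\<integral>\<omega>. f \<omega> \<partial>Q)"
      by (intro integral_mono int f continuous_intros c bd)+
    then show ?thesis
      using sums[OF ps(1)] by (simp add: int c P.prob_space Q.prob_space abs_le_iff)
  qed
  then have "\<bar>(\<integral>\<omega>. f \<omega> \<partial>P) - (\<integral>\<omega>. f \<omega> \<partial>Q)\<bar> \<le> 0" by (rule field_le_epsilon)
  then show "(\<integral>\<omega>. f \<omega> \<partial>P) = (\<integral>\<omega>. f \<omega> \<partial>Q)" by simp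
qed

section \<open>Words in a positive unital operator\<close>

text \<open>Both choices of \<open>V\<close> are treated together through three common features:
  \<open>V\<close> contains \<open>C_space\<close> and is closed under sums and products.\<close>

locale markov_operator =
  fixes V :: "('a::t2_space \<Rightarrow> real) set"
    and R :: "('a \<Rightarrow> real) \<Rightarrow> ('a \<Rightarrow> real)"
  assumes space: "V = C_space \<or> V = M_space"
    and linear: "linear_operator_on V R"
    and positive: "positive_operator_on V R"
    and unital: "R (\<lambda>_. 1) = (\<lambda>_. 1)"
begin

lemma C_subset_V: "C_space \<subseteq> V"
  using space by (auto simp: C_space_def M_space_def intro: borel_measurable_continuous_onI)

lemma V_add: "f \<in> V \<Longrightarrow> g \<in> V \<Longrightarrow> (\<lambda>y. f y + g y) \<in> V"
  using space by (auto simp: C_space_def M_space_def intro: continuous_intros)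

lemma V_mult: "f \<in> V \<Longrightarrow> g \<in> V \<Longrightarrow> (\<lambda>y. f y * g y) \<in> V"
  using space by (auto simp: C_space_def M_space_def intro: continuous_intros)

lemma V_const: "(\<lambda>_. c) \<in> V"
  using C_subset_V const_in_C_space by blast

lemma R_in_V: "f \<in> V \<Longrightarrow> R f \<in> V"
  using linear by (simp add: linear_operator_on_def)

lemma R_add: "f \<in> V \<Longrightarrow> g \<in> V \<Longrightarrow> R (\<lambda>y. f y + g y) = (\<lambda>y. R f y + R g y)"
  using linear by (simp add: linear_operator_on_def)

lemma R_scale: "f \<in> V \<Longrightarrow> R (\<lambda>y. c * f y) = (\<lambda>y. c * R f y)"
  using linear by (simp add: linear_operator_on_def)

lemma R_nonneg: "f \<in> V \<Longrightarrow> (\<And>y. 0 \<le> f y) \<Longrightarrow> 0 \<le> R f y"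
  using positive by (simp add: positive_operator_on_def)

abbreviation word :: "('a \<Rightarrow> real) list \<Rightarrow> 'a \<Rightarrow> real" where
  "word \<phi>s \<equiv> op_word R \<phi>s (\<lambda>_. 1)"

text \<open>A uniform recursion that also covers one-letter words: there \<open>op_word\<close> has
  no \<open>R\<close>, but \<open>word []\<close> is the constant 1, and \<open>R\<close> fixes
  it.\<close>

lemma word_Cons: "word (\<phi> # \<phi>s) = (\<lambda>y. \<phi> y * R (word \<phi>s) y)"
  by (cases \<phi>s) (auto simp: mult_op_def unital)

lemma word_in_V: "set \<phi>s \<subseteq> C_space \<Longrightarrow> word \<phi>s \<in> V"
proof (induction \<phi>s)
  case Nil
  then show ?case by (simp add: V_const)
next
  case (Cons \<phi> \<phi>s)
  then have "R (word \<phi>s) \<in> V" "\<phi> \<in> V"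
    using R_in_V C_subset_V by auto
  then show ?case unfolding word_Cons by (rule V_mult[rotated])
qed

section \<open>Values of linear combinations of words\<close>

definition word_sum :: "(real \<times> ('a \<Rightarrow> real) list) list \<Rightarrow> 'a \<Rightarrow> real" where
  "word_sum ps y = (\<Sum>p\<leftarrow>ps. fst p * word (snd p) y)"

lemma word_sum_simps:
  "word_sum [] y = 0"
  "word_sum (p # ps) y = fst p * word (snd p) y + word_sum ps y"
  "word_sum (ps @ qs) y = word_sum ps y + word_sum qs y"
  by (auto simp: word_sum_def)

lemma word_sum_scale: "word_sum (map (\<lambda>p. (c * fst p, snd p)) ps) y = c * word_sum ps y"
  by (induction ps) (auto simp: word_sum_simps algebra_simps)

text \<open>Additivity of \<open>R\<close> is available only for two summands lying in
  \<open>V\<close>, so membership in \<open>V\<close> has to be carried along in the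
  induction.\<close>

lemma R_word_sum:
  assumes "continuous_code ps"
  shows "word_sum ps \<in> V \<and> R (word_sum ps) = (\<lambda>y. \<Sum>p\<leftarrow>ps. fst p * R (word (snd p)) y)"
  using assms
proof (induction ps)
  case Nil
  have "R (\<lambda>_. 0) = (\<lambda>_. 0)"
    using R_scale[OF V_const[of 1], of 0] by simp
  moreover have "word_sum [] = (\<lambda>_. 0)" by (simp add: word_sum_simps fun_eq_iff)
  ultimately show ?case using V_const[of 0] by simp
next
  case (Cons p ps)
  let ?w = "\<lambda>y. fst p * word (snd p) y"
  have IH: "word_sum ps \<in> V" "R (word_sum ps) = (\<lambda>y. \<Sum>p\<leftarrow>ps. fst p * R (word (snd p)) y)"
    and w: "word (snd p) \<in> V"
    using Cons by (auto simp: continuous_code_simps intro: word_in_V)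
  have wV: "?w \<in> V" by (rule V_mult[OF V_const w])
  have eq: "word_sum (p # ps) = (\<lambda>y. ?w y + word_sum ps y)"
    by (simp add: word_sum_simps fun_eq_iff)
  show ?case
    unfolding eq R_add[OF wV IH(1)] R_scale[OF w] IH(2) using V_add[OF wV IH(1)] by simp
qed

text \<open>The first coordinate \<open>z\<close> is frozen and absorbed into the coefficients; the induction
  hypothesis makes the resulting combination of shorter words nonnegative everywhere, and
  applying \<open>R\<close> to it and evaluating at the same \<open>z\<close> gives the claim.\<close>

lemma word_sum_nonneg:
  assumes "continuous_code ps" "\<And>p. p \<in> set ps \<Longrightarrow> length (snd p) \<le> n"
    and "\<And>\<omega>. 0 \<le> tensor_sum ps \<omega>"
  shows "0 \<le> word_sum ps z"
  using assms
proof (induction n arbitrary: ps z)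
  case 0
  have "word_sum ps z = tensor_sum ps (\<lambda>_. z)"
    unfolding word_sum_def tensor_sum_def
    using 0(2) by (intro arg_cong[of _ _ sum_list] map_cong) (auto simp: tensor_Nil)
  then show ?case using 0(3) by simp
next
  case (Suc n)
  \<comment> \<open>The first letter, or 1 for the empty word. Because \<open>tl [] = []\<close>,
    this lets empty words pass through the same step as all others, using
    \<open>R 1 = 1\<close>.\<close>
  define h :: "('a \<Rightarrow> real) list \<Rightarrow> 'a \<Rightarrow> real"
    where "h \<phi>s = (case \<phi>s of [] \<Rightarrow> (\<lambda>_. 1) | \<phi> # _ \<Rightarrow> \<phi>)" for \<phi>s
  have tensor_h: "tensor \<phi>s \<omega> = h \<phi>s (\<omega> 0) * tensor (tl \<phi>s) (\<lambda>i. \<omega> (Suc i))" for \<phi>s \<omega>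
    by (cases \<phi>s) (auto simp: h_def tensor_Nil tensor_Cons)
  have word_h: "word \<phi>s y = h \<phi>s y * R (word (tl \<phi>s)) y" for \<phi>s y
    by (cases \<phi>s) (auto simp: h_def word_Cons unital)
  define qs where "qs = map (\<lambda>p. (fst p * h (snd p) z, tl (snd p))) ps"
  have "set (tl \<phi>s) \<subseteq> C_space" if "set \<phi>s \<subseteq> C_space" for \<phi>s :: "('a \<Rightarrow> real) list"
    using that by (cases \<phi>s) auto
  then have qs: "continuous_code qs"
    using Suc.prems(1) by (simp add: qs_def continuous_code_def)
  have "tensor_sum qs \<omega> = tensor_sum ps (case_nat z \<omega>)" for \<omega>
    unfolding qs_def tensor_sum_def by (simp add: o_def tensor_h[of _ "case_nat z \<omega>"] mult.assoc)
  then have "0 \<le> word_sum qs y" for y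
    using Suc.prems(2,3) by (intro Suc.IH[OF qs]) (fastforce simp: qs_def)+
  then have "0 \<le> R (word_sum qs) z"
    using R_word_sum[OF qs] by (intro R_nonneg) auto
  also have "R (word_sum qs) z = word_sum ps z"
    using R_word_sum[OF qs]
    by (simp add: qs_def word_sum_def o_def word_h[of "snd _"] mult.assoc)
  finally show ?case .
qed

lemma exists_representing_measure:
  assumes compact: "compact (UNIV :: 'a set)"
  shows "\<exists>P. regular_borel_prob P \<and>
           (\<forall>\<phi>s. set \<phi>s \<subseteq> C_space \<longrightarrow> (\<integral>\<omega>. tensor \<phi>s \<omega> \<partial>P) = word \<phi>s x)"
proof -
  \<comment> \<open>Two codes of the same function could give different second components here;
    positivity, verified below, is what excludes it.\<close>
  define G where "G = {(tensor_sum ps, word_sum ps x) |ps. continuous_code ps}"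
  obtain L where L: "\<And>g r. (g, r) \<in> G \<Longrightarrow> continuous_on UNIV g \<Longrightarrow> L g = r"
    "\<And>f g. continuous_on UNIV f \<Longrightarrow> continuous_on UNIV g \<Longrightarrow> L (\<lambda>x. f x + g x) = L f + L g"
    "\<And>c f. continuous_on UNIV f \<Longrightarrow> L (\<lambda>x. c * f x) = c * L f"
    "\<And>f. continuous_on UNIV f \<Longrightarrow> \<forall>x. 0 \<le> f x \<Longrightarrow> 0 \<le> L f"
  proof (rule positive_extension[of G])
    fix f g r s assume "(f, r) \<in> G" "(g, s) \<in> G"
    then obtain ps qs where "f = tensor_sum ps" "r = word_sum ps x" "g = tensor_sum qs"
      "s = word_sum qs x" "continuous_code ps" "continuous_code qs" by (auto simp: G_def)
    then show "(\<lambda>x. f x + g x, r + s) \<in> G"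
      unfolding G_def
      by (auto intro!: exI[of _ "ps @ qs"] simp: tensor_sum_simps word_sum_simps continuous_code_simps)
  next
    fix c f r assume "(f, r) \<in> G"
    then obtain ps where "f = tensor_sum ps" "r = word_sum ps x" "continuous_code ps"
      by (auto simp: G_def)
    then show "(\<lambda>x. c * f x, c * r) \<in> G"
      unfolding G_def
      by (auto intro!: exI[of _ "map (\<lambda>p. (c * fst p, snd p)) ps"]
          simp: tensor_sum_scale word_sum_scale continuous_code_scale)
  next
    fix f r assume "(f, r) \<in> G" and pos: "\<And>x. 0 \<le> f x"
    then obtain ps where ps: "f = tensor_sum ps" "r = word_sum ps x" "continuous_code ps"
      by (auto simp: G_def)
    \<comment> \<open>Any common length bound serves for the induction; inserting 0 keeps the
      maximum meaningful for the empty code.\<close>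
    have "length (snd p) \<le> Max (insert 0 ((\<lambda>p. length (snd p)) ` set ps))" if "p \<in> set ps" for p
      using that by (intro Max_ge) auto
    from word_sum_nonneg[OF ps(3) this] show "0 \<le> r" using pos ps by simp
  next
    show "(\<lambda>_. 1, 1) \<in> G"
      unfolding G_def by (auto intro!: exI[of _ "[(1, [])]"]
          simp: tensor_sum_simps word_sum_simps continuous_code_simps tensor_Nil)
  next
    fix f :: "(nat \<Rightarrow> 'a) \<Rightarrow> real" and e :: real assume "continuous_on UNIV f" "0 < e"
    from tensor_sum_dense[OF compact this]
    obtain ps where "continuous_code ps" "\<And>\<omega>. \<bar>f \<omega> - tensor_sum ps \<omega>\<bar> < e" by blast
    then show "\<exists>g r. (g, r) \<in> G \<and> (\<forall>x. \<bar>f x - g x\<bar> < e)"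
      unfolding G_def by blast
  qed (rule that)
  have Lt: "L (tensor \<phi>s) = word \<phi>s x" if "set \<phi>s \<subseteq> C_space" for \<phi>s
  proof -
    have "(tensor_sum [(1, \<phi>s)], word_sum [(1, \<phi>s)] x) \<in> G"
      unfolding G_def using that by (auto simp: continuous_code_simps)
    moreover have "tensor_sum [(1, \<phi>s)] = tensor \<phi>s" "word_sum [(1, \<phi>s)] x = word \<phi>s x"
      by (auto simp: tensor_sum_simps word_sum_simps)
    ultimately show ?thesis using L(1) continuous_on_tensor[OF that] by simp
  qed
  \<comment> \<open>The empty word supplies the normalization, its tensor and its word both being
    the constant 1.\<close>
  have "L (\<lambda>_. 1) = 1"
    using Lt[of "[]"] by (simp add: tensor_Nil[abs_def])
  then interpret positive_functional L
    using L(2-4) compact_UNIV_fun[OF compact] by unfold_locales auto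
  obtain P where "regular_borel_prob P" "\<And>f. continuous_on UNIV f \<Longrightarrow> (\<integral>\<omega>. f \<omega> \<partial>P) = L f"
    using Riesz_Markov by blast
  then show ?thesis by (auto simp: continuous_on_tensor Lt)
qed

end

theorem theorem2p11:
  fixes V :: "('a::t2_space \<Rightarrow> real) set"
    and R :: "('a \<Rightarrow> real) \<Rightarrow> ('a \<Rightarrow> real)"
  assumes "compact (UNIV :: 'a set)"
    and "V = C_space \<or> V = M_space"
    and "linear_operator_on V R"
    and "positive_operator_on V R"
    and "R (\<lambda>_. 1) = (\<lambda>_. 1)"
  shows "\<forall>x. \<exists>!P :: (nat \<Rightarrow> 'a) measure. regular_borel_prob P \<and>
           (\<forall>\<phi>s. \<phi>s \<noteq> [] \<and> set \<phi>s \<subseteq> C_space \<longrightarrow>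
              (\<integral>\<omega>. tensor \<phi>s \<omega> \<partial>P) = op_word R \<phi>s (\<lambda>_. 1) x)"
proof
  fix x
  interpret markov_operator V R by unfold_locales (rule assms)+
  obtain P where P: "regular_borel_prob P"
      "\<And>\<phi>s. set \<phi>s \<subseteq> C_space \<Longrightarrow> (\<integral>\<omega>. tensor \<phi>s \<omega> \<partial>P) = op_word R \<phi>s (\<lambda>_. 1) x"
    using exists_representing_measure[OF assms(1)] by blast
  show "\<exists>!P :: (nat \<Rightarrow> 'a) measure. regular_borel_prob P \<and>
           (\<forall>\<phi>s. \<phi>s \<noteq> [] \<and> set \<phi>s \<subseteq> C_space \<longrightarrow>
              (\<integral>\<omega>. tensor \<phi>s \<omega> \<partial>P) = op_word R \<phi>s (\<lambda>_. 1) x)"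
  proof (rule ex1I[of _ P])
    fix Q :: "(nat \<Rightarrow> 'a) measure"
    assume "regular_borel_prob Q \<and> (\<forall>\<phi>s. \<phi>s \<noteq> [] \<and> set \<phi>s \<subseteq> C_space \<longrightarrow>
              (\<integral>\<omega>. tensor \<phi>s \<omega> \<partial>Q) = op_word R \<phi>s (\<lambda>_. 1) x)"
    then show "Q = P"
      using P by (intro regular_borel_prob_eqI_tensor[OF assms(1)]) auto
  qed (use P in blast)
qed

end
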